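(* Let $0=n_0<n_1<\cdots<n_k=n$ be integers and let $p(q)=\sum_{\nu=0}^{k} q^{n_\nu}a_{n_\nu}$ be a quaternionic polynomial with $a_n\ne 0$, where $a_{n_l}=\alpha_{n_l}+\beta_{n_l}\mathbf{i}+\gamma_{n_l}\mathbf{j}+\delta_{n_l}\mathbf{k}$ with $\alpha_{n_l},\beta_{n_l},\gamma_{n_l},\delta_{n_l}\in\mathbb{R}$ for $l=0,1,\dots,k$. Suppose that $a_{n_l}\ne a_{n_{l+1}}$ for $l=0,1,\dots,k-1$, that $$\alpha_{n_0}\le\alpha_{n_1}\le\cdots\le\alpha_{n_k},\qquad \beta_{n_0}\ge\beta_{n_1}\ge\cdots\ge\beta_{n_k},$$ and that for some $r$ with $0\le r\le k$, $$\gamma_{n_0}\le\gamma_{n_1}\le\cdots\le\gamma_{n_{r-1}}\le\gamma_{n_r}\ge\gamma_{n_{r+1}}\ge\cdots\ge\gamma_{n_k}.$$ For $1\le j\le k$ let $$M_{n_j}=\max_{|q|=1}\frac{\left|q^{n_j}a_{n_j}-q^{n_{j-1}+1}a_{n_{j-1}}\right|}{\left|a_{n_j}-a_{n_{j-1}}\right|},\qquad M=\max_{1\le j\le k}M_{n_j}.$$ Then every $q\in\mathbb{H}$ with $p(q)=0$ satisfies $$|q|\le\frac{M}{|a_n|}\left\{(\alpha_n-\alpha_0)+(\beta_0-\beta_n)+2\gamma_{n_r}-(\gamma_0+\gamma_n)+2\sum_{j=0}^{k-1}|\delta_{n_j}|+|\delta_n|+|\alpha_0|+|\beta_0|+|\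gamma_0|\right\}.$$
   Context: $\mathbb{H}$ is the skew field of real quaternions with standard units $\mathbf{i},\mathbf{j},\mathbf{k}$ and norm $|q|=\sqrt{q\bar q}$. Polynomials have a quaternionic variable $q$ with coefficients written on the right: $p(q)=\sum_\nu q^\nu a_\nu$, evaluated at quaternions by substitution. Since $n_0=0$ and $n_k=n$, $a_0=a_{n_0}$, $a_n=a_{n_k}$, and likewise $\alpha_0=\alpha_{n_0}$, $\alpha_n=\alpha_{n_k}$, and so on for $\beta,\gamma,\delta$. The maximum in the definition of $M_{n_j}$ is over all $q\in\mathbb{H}$ with $|q|=1$. *)

theory Defs
  imports "HOL-Analysis.Analysis"
begin

section \<open>The skew field of real quaternions\<close>

codatatype quat = Quat (qRe: real) (qIm1: real) (qIm2: real) (qIm3: real)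

lemma quat_eqI:
  "\<lbrakk>qRe x = qRe y; qIm1 x = qIm1 y; qIm2 x = qIm2 y; qIm3 x = qIm3 y\<rbrakk> \<Longrightarrow> x = y"
  by (rule quat.expand) simp

lemma quat_eq_iff:
  "x = y \<longleftrightarrow> qRe x = qRe y \<and> qIm1 x = qIm1 y \<and> qIm2 x = qIm2 y \<and> qIm3 x = qIm3 y"
  by (auto intro: quat_eqI)

instantiation quat :: ab_group_add
begin

primcorec zero_quat where
  "qRe 0 = 0" | "qIm1 0 = 0" | "qIm2 0 = 0" | "qIm3 0 = 0"

primcorec plus_quat where
  "qRe (x + y) = qRe x + qRe y"
| "qIm1 (x + y) = qIm1 x + qIm1 y"
| "qIm2 (x + y) = qIm2 x + qIm2 y"
| "qIm3 (x + y) = qIm3 x + qIm3 y"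

primcorec uminus_quat where
  "qRe (- x) = - qRe x"
| "qIm1 (- x) = - qIm1 x"
| "qIm2 (- x) = - qIm2 x"
| "qIm3 (- x) = - qIm3 x"

primcorec minus_quat where
  "qRe (x - y) = qRe x - qRe y"
| "qIm1 (x - y) = qIm1 x - qIm1 y"
| "qIm2 (x - y) = qIm2 x - qIm2 y"
| "qIm3 (x - y) = qIm3 x - qIm3 y"

instance
  by standard (simp_all add: quat_eq_iff)

end

instantiation quat :: real_algebra_1
begin

primcorec one_quat where
  "qRe 1 = 1" | "qIm1 1 = 0" | "qIm2 1 = 0" | "qIm3 1 = 0"

primcorec times_quat where
  "qRe (x * y) = qRe x * qRe y - qIm1 x * qIm1 y - qIm2 x * qIm2 y - qIm3 x * qIm3 y"
| "qIm1 (x * y) = qRe x * qIm1 y + qIm1 x * qRe y + qIm2 x * qIm3 y - qIm3 x * qIm2 y"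
| "qIm2 (x * y) = qRe x * qIm2 y - qIm1 x * qIm3 y + qIm2 x * qRe y + qIm3 x * qIm1 y"
| "qIm3 (x * y) = qRe x * qIm3 y + qIm1 x * qIm2 y - qIm2 x * qIm1 y + qIm3 x * qRe y"

primcorec scaleR_quat where
  "qRe (scaleR r x) = r * qRe x"
| "qIm1 (scaleR r x) = r * qIm1 x"
| "qIm2 (scaleR r x) = r * qIm2 x"
| "qIm3 (scaleR r x) = r * qIm3 x"

instance
  by standard (simp_all add: quat_eq_iff algebra_simps)

end

instantiation quat :: real_inner
begin

definition inner_quat :: "quat \<Rightarrow> quat \<Rightarrow> real" where
  "inner_quat x y = qRe x * qRe y + qIm1 x * qIm1 y + qIm2 x * qIm2 y + qIm3 x * qIm3 y"

definition norm_quat :: "quat \<Rightarrow> real" where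
  "norm_quat x = sqrt ((qRe x)\<^sup>2 + (qIm1 x)\<^sup>2 + (qIm2 x)\<^sup>2 + (qIm3 x)\<^sup>2)"

definition sgn_quat :: "quat \<Rightarrow> quat" where
  "sgn_quat x = x /\<^sub>R norm x"

definition dist_quat :: "quat \<Rightarrow> quat \<Rightarrow> real" where
  "dist_quat x y = norm (x - y)"

definition uniformity_quat :: "(quat \<times> quat) filter" where
  "uniformity_quat = (INF e\<in>{0 <..}. principal {(x, y). dist x y < e})"

definition open_quat :: "quat set \<Rightarrow> bool" where
  "open_quat U \<longleftrightarrow> (\<forall>x\<in>U. eventually (\<lambda>(x', y). x' = x \<longrightarrow> y \<in> U) uniformity)"

instance
proof
  fix x y z :: quat and r :: real and U :: "quat set"
  show "dist x y = norm (x - y)" by (rule dist_quat_def)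
  show "sgn x = x /\<^sub>R norm x" by (rule sgn_quat_def)
  show "(uniformity :: (quat \<times> quat) filter) = (INF e\<in>{0 <..}. principal {(x, y). dist x y < e})"
    by (rule uniformity_quat_def)
  show "open U \<longleftrightarrow> (\<forall>x\<in>U. eventually (\<lambda>(x', y). x' = x \<longrightarrow> y \<in> U) uniformity)"
    by (rule open_quat_def)
  show "inner x y = inner y x"
    by (simp add: inner_quat_def mult.commute)
  show "inner (x + y) z = inner x z + inner y z"
    by (simp add: inner_quat_def distrib_right)
  show "inner (scaleR r x) y = r * inner x y"
    by (simp add: inner_quat_def distrib_left)
  show "0 \<le> inner x x"
    by (simp add: inner_quat_def)
  show "inner x x = 0 \<longleftrightarrow> x = 0"
    by (auto simp: inner_quat_def quat_eq_iff add_nonneg_eq_0_iff)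
  show "norm x = sqrt (inner x x)"
    by (simp add: inner_quat_def norm_quat_def power2_eq_square)
qed

end

definition quat_i :: quat where "quat_i = Quat 0 1 0 0"
definition quat_j :: quat where "quat_j = Quat 0 0 1 0"
definition quat_k :: quat where "quat_k = Quat 0 0 0 1"

lemmas quat_unit_defs = quat_i_def quat_j_def quat_k_def

lemma quat_unit_mult:
  "quat_i * quat_i = -1" "quat_j * quat_j = -1" "quat_k * quat_k = -1"
  "quat_i * quat_j = quat_k" "quat_j * quat_k = quat_i" "quat_k * quat_i = quat_j"
  "quat_j * quat_i = - quat_k" "quat_k * quat_j = - quat_i" "quat_i * quat_k = - quat_j"
  by (simp_all add: quat_unit_defs quat_eq_iff)

instantiation quat :: euclidean_space
begin

definition Basis_quat :: "quat set" where
  "Basis_quat = {1, quat_i, quat_j, quat_k}"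

instance
proof
  show "(Basis :: quat set) \<noteq> {}" and "finite (Basis :: quat set)"
    by (simp_all add: Basis_quat_def)
  show "inner u v = (if u = v then 1 else 0)" if "u \<in> Basis" "v \<in> Basis" for u v :: quat
    using that unfolding Basis_quat_def
    by (elim insertE emptyE) (simp_all add: quat_unit_defs inner_quat_def quat_eq_iff)
  show "(\<forall>u\<in>Basis. inner x u = 0) \<longleftrightarrow> x = 0" for x :: quat
    unfolding Basis_quat_def ball_simps
    by (simp add: quat_unit_defs inner_quat_def quat_eq_iff)
qed

end

definition qcnj :: "quat \<Rightarrow> quat" where
  "qcnj x = Quat (qRe x) (- qIm1 x) (- qIm2 x) (- qIm3 x)"

instantiation quat :: real_normed_div_algebra
begin

definition inverse_quat :: "quat \<Rightarrow> quat" where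
  "inverse_quat x = qcnj x /\<^sub>R (norm x)\<^sup>2"

definition divide_quat :: "quat \<Rightarrow> quat \<Rightarrow> quat" where
  "divide_quat x y = x * inverse y"

instance
proof
  fix x y :: quat
  have n2: "(norm z)\<^sup>2 = (qRe z)\<^sup>2 + (qIm1 z)\<^sup>2 + (qIm2 z)\<^sup>2 + (qIm3 z)\<^sup>2" for z :: quat
    by (simp add: norm_quat_def)
  have "(norm (x * y))\<^sup>2 = (norm x * norm y)\<^sup>2"
    unfolding power_mult_distrib n2 by (simp add: power2_eq_square algebra_simps)
  then show "norm (x * y) = norm x * norm y"
    by (metis norm_ge_zero mult_nonneg_nonneg power2_eq_imp_eq)
  have l: "qcnj x * x = ((norm x)\<^sup>2) *\<^sub>R 1" and r: "x * qcnj x = ((norm x)\<^sup>2) *\<^sub>R 1"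
    unfolding n2 by (simp_all add: quat_eq_iff qcnj_def power2_eq_square)
  show "inverse x * x = 1" "x * inverse x = 1" if "x \<noteq> 0"
    using that by (simp_all add: inverse_quat_def l r)
  show "x div y = x * inverse y" by (rule divide_quat_def)
  show "inverse (0::quat) = 0"
    by (simp add: inverse_quat_def)
qed

end

lemma quat_mult_cnj: "q * qcnj q = of_real ((norm q)\<^sup>2)"
  by (simp add: quat_eq_iff qcnj_def norm_quat_def of_real_def power2_eq_square)

lemma quat_norm_eq_sqrt_mult_cnj: "norm q = sqrt (qRe (q * qcnj q))"
  by (simp add: quat_mult_cnj of_real_def)

lemma quat_decomposition:
  "Quat a b c d = of_real a + of_real b * quat_i + of_real c * quat_j + of_real d * quat_k"
  by (simp add: quat_eq_iff quat_unit_defs of_real_def)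


section \<open>The constants in the zero bound\<close>

text \<open>
  The coefficient family is indexed by the exponents, so that \<open>a (n l)\<close> is the coefficient of
  \<open>q ^ n l\<close>.
\<close>

definition gap_ratio :: "(nat \<Rightarrow> nat) \<Rightarrow> (nat \<Rightarrow> quat) \<Rightarrow> nat \<Rightarrow> quat \<Rightarrow> real" where
  "gap_ratio n a j q =
     norm (q ^ n j * a (n j) - q ^ (n (j - 1) + 1) * a (n (j - 1))) / norm (a (n j) - a (n (j - 1)))"

definition gap_max :: "(nat \<Rightarrow> nat) \<Rightarrow> (nat \<Rightarrow> quat) \<Rightarrow> nat \<Rightarrow> real" where
  "gap_max n a j = (GREATEST x. \<exists>q. norm q = 1 \<and> x = gap_ratio n a j q)"

definition gap_bound :: "(nat \<Rightarrow> nat) \<Rightarrow> (nat \<Rightarrow> quat) \<Rightarrow> nat \<Rightarrow> real" where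
  "gap_bound n a k = Max (gap_max n a ` {1..k})"

text \<open>\<open>Max\<close> is only meaningful on finite sets and \<open>GREATEST\<close> only when a greatest element exists;
  the latter holds here because the unit sphere is compact.\<close>

lemma
  shows gap_max_attained: "\<exists>q. norm q = 1 \<and> gap_max n a j = gap_ratio n a j q"
    and gap_max_upper: "norm q = 1 \<Longrightarrow> gap_ratio n a j q \<le> gap_max n a j"
proof -
  have "continuous_on (sphere 0 1) (gap_ratio n a j)"
    unfolding gap_ratio_def divide_inverse by (intro continuous_intros)
  moreover have "(1::quat) \<in> sphere 0 1" by simp
  ultimately obtain q0 where q0: "q0 \<in> sphere 0 1"
      and max: "\<forall>q\<in>sphere 0 1. gap_ratio n a j q \<le> gap_ratio n a j q0"
    using continuous_attains_sup[OF compact_sphere] by (metis empty_iff)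
  then have eq: "gap_max n a j = gap_ratio n a j q0"
    unfolding gap_max_def by (intro Greatest_equality) auto
  show "\<exists>q. norm q = 1 \<and> gap_max n a j = gap_ratio n a j q"
    using q0 eq by auto
  show "gap_ratio n a j q \<le> gap_max n a j" if "norm q = 1"
    using that max eq by auto
qed

end

theory Submission
  imports Defs
begin

text \<open>
  If \<open>p(q) = 0\<close>, then expanding \<open>(1 - q) p(q) = 0\<close> and collecting consecutive terms gives
  \<open>q\<^bsup>n+1\<^esup> a\<^sub>n = a\<^sub>0 + \<Sum>\<^sub>j g\<^sub>j(q)\<close> with \<open>g\<^sub>j\<close> the two-term polynomial in the numerator of
  \<open>M\<^sub>j\<close>. A maximum principle for \<open>q\<^bsup>-n\<^esup> g\<^sub>j(q)\<close> outside the unit ball gives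
  \<open>|g\<^sub>j(q)| \<le> M\<^sub>j |a\<^sub>j - a\<^sub>j\<^sub>-\<^sub>1| |q|\<^bsup>n\<^esup>\<close> for \<open>|q| \<ge> 1\<close>. Since \<open>M\<^sub>j \<ge> 1\<close> (take \<open>q = 1\<close>), this bounds
  \<open>|q|\<close> by \<open>M / |a\<^sub>n|\<close> times the length \<open>|a\<^sub>0| + \<Sum>\<^sub>j |a\<^sub>j - a\<^sub>j\<^sub>-\<^sub>1|\<close> of the coefficient path, whose
  components telescope by monotonicity. If \<open>|q| < 1\<close>, it suffices that this length is at least
  \<open>|a\<^sub>n|\<close>.
\<close>

section \<open>Roots of quaternions through complex slices\<close>

text \<open>The slice of quaternions spanned by 1 and \<open>J\<close>; the map is multiplicative
  once \<open>J * J = -1\<close>.\<close>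

definition quat_of_complex :: "quat \<Rightarrow> complex \<Rightarrow> quat" where
  "quat_of_complex J z = of_real (Re z) + of_real (Im z) * J"

lemma quat_of_complex_mult:
  assumes "J * J = -1"
  shows "quat_of_complex J (z * w) = quat_of_complex J z * quat_of_complex J w"
proof -
  have "of_real x * J * (of_real y * J) = - (of_real (x * y) :: quat)" for x y
  proof -
    have "of_real x * J * (of_real y * J) = (x * y) *\<^sub>R (J * J)"
      by (simp add: of_real_def)
    then show ?thesis
      using assms by (simp add: of_real_def)
  qed
  then show ?thesis
    by (simp add: quat_of_complex_def algebra_simps) (simp add: of_real_def algebra_simps)
qed

lemma quat_of_complex_power:
  assumes "J * J = -1"
  shows "quat_of_complex J (z ^ m) = quat_of_complex J z ^ m"
  by (induction m) (simp_all add: quat_of_complex_mult[OF assms], simp add: quat_of_complex_def)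

text \<open>A nonzero imaginary part, normalised to length 1, serves as \<open>J\<close>.\<close>

lemma quat_in_complex_slice:
  obtains J z where "J * J = -1" "u = quat_of_complex J z"
proof -
  define s where "s = sqrt ((qIm1 u)\<^sup>2 + (qIm2 u)\<^sup>2 + (qIm3 u)\<^sup>2)"
  have s2: "s * s = (qIm1 u)\<^sup>2 + (qIm2 u)\<^sup>2 + (qIm3 u)\<^sup>2"
    unfolding s_def by simp
  show ?thesis
  proof (cases "s = 0")
    case True
    then have "(qIm1 u)\<^sup>2 + (qIm2 u)\<^sup>2 + (qIm3 u)\<^sup>2 = 0"
      using s2 by simp
    then have "qIm1 u = 0" "qIm2 u = 0" "qIm3 u = 0"
      by (auto simp: add_nonneg_eq_0_iff)
    \<comment> \<open>A real quaternion lies in every slice; \<open>quat_i\<close> is an arbitrary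
      choice.\<close>
    then have "u = quat_of_complex quat_i (Complex (qRe u) 0)"
      by (simp add: quat_eq_iff quat_of_complex_def of_real_def)
    then show ?thesis
      using that quat_unit_mult(1) by blast
  next
    case False
    define J where "J = Quat 0 (qIm1 u / s) (qIm2 u / s) (qIm3 u / s)"
    have "qIm1 u / s * (qIm1 u / s) + qIm2 u / s * (qIm2 u / s) + qIm3 u / s * (qIm3 u / s)
        = ((qIm1 u)\<^sup>2 + (qIm2 u)\<^sup>2 + (qIm3 u)\<^sup>2) / (s * s)"
      by (simp add: add_divide_distrib power2_eq_square)
    also have "\<dots> = 1"
      using False by (simp flip: s2)
    finally have "J * J = -1"
      by (simp add: quat_eq_iff J_def)
    moreover have "u = quat_of_complex J (Complex (qRe u) s)"
      using False by (simp add: quat_eq_iff J_def quat_of_complex_def of_real_def)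
    ultimately show ?thesis
      using that by blast
  qed
qed

text \<open>A complex root taken inside a slice containing \<open>u\<close> is a quaternionic
  root.\<close>

lemma quat_root_exists:
  fixes u :: quat
  assumes "m > 0"
  obtains w where "w ^ m = u"
proof -
  obtain J z where J: "J * J = -1" and u: "u = quat_of_complex J z"
    by (rule quat_in_complex_slice)
  obtain c where c: "c ^ m = z"
  proof (cases "z = 0")
    case True
    then show ?thesis
      using that[of 0] assms by simp
  next
    case False
    have "exp (Ln z / of_nat m) ^ m = z"
      using assms False by (simp flip: exp_of_nat_mult)
    then show ?thesis
      by (rule that)
  qed
  show ?thesis
    using that[of "quat_of_complex J c"] quat_of_complex_power[OF J, of c m] c u by simp
qed

section \<open>Two-term polynomials outside the unit ball\<close>

text \<open>The vector \<open>x - t *\<^sub>R y\<close> is a convex combination of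
  \<open>x - y\<close> and \<open>x + y\<close>, and balls are convex.\<close>

lemma norm_diff_scaleR_le:
  fixes x y :: "'a::real_normed_vector"
  assumes "0 \<le> t" "t \<le> 1" "norm (x - y) \<le> C" "norm (x + y) \<le> C"
  shows "norm (x - t *\<^sub>R y) \<le> C"
proof -
  have "x - t *\<^sub>R y = ((1 + t) / 2) *\<^sub>R (x - y) + ((1 - t) / 2) *\<^sub>R (x + y)"
  proof -
    have "((1 + t) / 2) *\<^sub>R (x - y) + ((1 - t) / 2) *\<^sub>R (x + y)
        = ((1 + t) / 2 + (1 - t) / 2) *\<^sub>R x - ((1 + t) / 2 - (1 - t) / 2) *\<^sub>R y"
      unfolding scaleR_left_distrib scaleR_left_diff_distrib by (simp add: algebra_simps)
    moreover have "(1 + t) / 2 + (1 - t) / 2 = 1" and "(1 + t) / 2 - (1 - t) / 2 = t"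
      by (simp_all add: field_simps)
    ultimately show ?thesis
      by simp
  qed
  also have "\<dots> \<in> cball 0 C"
    by (rule convexD[OF convex_cball]) (use assms in \<open>auto simp: field_simps\<close>)
  finally show ?thesis
    by simp
qed

text \<open>Replaces the maximum modulus principle: on the ray through a unit \<open>s\<close>, the norm is convex in
  \<open>|q|\<^bsup>-m\<^esup>\<close>, and the value at the opposite end \<open>-1\<close> is also attained on the sphere since \<open>-s\<^sup>m\<close> has an
  \<open>m\<close>-th root.\<close>
lemma norm_binomial_le_outside_ball:
  fixes a b q :: quat
  assumes bound: "\<And>s. norm s = 1 \<Longrightarrow> norm (s ^ N * a - s ^ (L + 1) * b) \<le> C"
    and "L < N" "1 \<le> norm q"
  shows "norm (q ^ N * a - q ^ (L + 1) * b) \<le> C * norm q ^ N"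
proof -
  define m where "m = N - (L + 1)"
  have N: "N = (L + 1) + m"
    using \<open>L < N\<close> by (simp add: m_def)
  \<comment> \<open>With coefficients on the right, the common power of \<open>w\<close> comes out
    on the left, and the norm is multiplicative.\<close>
  have factor: "norm (w ^ N * a - w ^ (L + 1) * b) = norm w ^ (L + 1) * norm (w ^ m * a - b)"
    for w :: quat
  proof -
    have "w ^ N * a - w ^ (L + 1) * b = w ^ (L + 1) * (w ^ m * a - b)"
      unfolding N power_add right_diff_distrib by (simp add: mult.assoc)
    then show ?thesis
      by (simp only: norm_mult norm_power)
  qed
  have bound': "norm (s ^ m * a - b) \<le> C" if "norm s = 1" for s :: quat
    using bound[OF that] unfolding factor that by simp
  define R where "R = norm q"
  have R: "1 \<le> R"
    using assms by (simp add: R_def)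
  define s where "s = q /\<^sub>R R"
  have s: "norm s = 1" and q: "q = R *\<^sub>R s"
    using R by (auto simp: s_def simp flip: R_def)
  have R_m: "1 \<le> R ^ m"
    using R by simp
  have "norm (s ^ m * a - inverse (R ^ m) *\<^sub>R b) \<le> C"
  proof (cases "m = 0")
    \<comment> \<open>Here \<open>R ^ m = 1\<close>, so the bound at \<open>s\<close> is already the
      claim; a root of \<open>- (s ^ m)\<close> can be taken only for positive
      \<open>m\<close>.\<close>
    case True
    then show ?thesis
      using bound'[OF s] by simp
  next
    case False
    then obtain w where w: "w ^ m = - (s ^ m)"
      using quat_root_exists[of m "- (s ^ m)"] by auto
    have "norm w ^ m = 1"
      using w s by (metis norm_minus_cancel norm_power power_one)
    then have "norm w = 1"
      using False by (metis norm_ge_zero power_eq_1_iff abs_of_nonneg real_norm_def)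
    then have "norm (- (s ^ m) * a - b) \<le> C"
      using bound'[of w] w by simp
    then have "norm (s ^ m * a + b) \<le> C"
      by (metis minus_add_distrib mult_minus_left norm_minus_cancel diff_conv_add_uminus)
    then show ?thesis
      using R_m by (intro norm_diff_scaleR_le bound' s) (auto simp: inverse_le_1_iff)
  qed
  moreover have "q ^ m * a - b = (R ^ m) *\<^sub>R (s ^ m * a - inverse (R ^ m) *\<^sub>R b)"
    using R by (simp add: q scaleR_power algebra_simps)
  ultimately have "norm (q ^ m * a - b) \<le> R ^ m * C"
    using R by (simp add: mult_left_mono)
  then have "R ^ (L + 1) * norm (q ^ m * a - b) \<le> R ^ (L + 1) * (R ^ m * C)"
    using R by (intro mult_left_mono) auto
  then have "norm (q ^ N * a - q ^ (L + 1) * b) \<le> R ^ (L + 1) * (R ^ m * C)"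
    unfolding factor by (simp only: R_def)
  then show ?thesis
    unfolding R_def[symmetric] by (simp add: N power_add mult_ac)
qed

lemma one_le_gap_max:
  assumes "a (n j) \<noteq> a (n (j - 1))"
  shows "1 \<le> gap_max n a j"
  using gap_max_upper[of 1 n a j] assms by (simp add: gap_ratio_def)

lemma gap_max_le_gap_bound: "1 \<le> j \<Longrightarrow> j \<le> k \<Longrightarrow> gap_max n a j \<le> gap_bound n a k"
  unfolding gap_bound_def by (rule Max_ge) auto

lemma norm_gap_le:
  assumes "n (j - 1) < n j" "a (n j) \<noteq> a (n (j - 1))" "1 \<le> norm q"
  shows "norm (q ^ n j * a (n j) - q ^ (n (j - 1) + 1) * a (n (j - 1)))
    \<le> gap_max n a j * norm (a (n j) - a (n (j - 1))) * norm q ^ n j"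
proof (rule norm_binomial_le_outside_ball)
  fix s :: quat
  assume "norm s = 1"
  from gap_max_upper[OF this, of n a j] show
    "norm (s ^ n j * a (n j) - s ^ (n (j - 1) + 1) * a (n (j - 1)))
      \<le> gap_max n a j * norm (a (n j) - a (n (j - 1)))"
    using assms by (simp add: gap_ratio_def divide_le_eq)
qed (use assms in auto)

section \<open>Bounding a zero by the length of the coefficient path\<close>

text \<open>Left multiplication by \<open>1 - q\<close> only meets powers of \<open>q\<close>, so
  nothing has to commute with the coefficients.\<close>

lemma one_minus_times_gapped_sum:
  fixes q :: "'a::ring_1"
  shows "(1 - q) * (\<Sum>\<nu>=0..k. q ^ n \<nu> * c \<nu>) =
    q ^ n 0 * c 0 + (\<Sum>l<k. q ^ n (Suc l) * c (Suc l) - q ^ (n l + 1) * c l) - q ^ (n k + 1) * c k"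
  by (induction k) (simp_all add: algebra_simps)

lemma norm_le_norm_first_plus_variation:
  fixes c :: "nat \<Rightarrow> 'a::real_normed_vector"
  shows "norm (c k) \<le> norm (c 0) + (\<Sum>l<k. norm (c (Suc l) - c l))"
proof -
  have "c k = c 0 + (\<Sum>l<k. c (Suc l) - c l)"
    by (simp add: sum_lessThan_telescope)
  then show ?thesis
    by (metis add_left_mono norm_sum norm_triangle_le)
qed

text \<open>The coordinate-free bound: only the path length remains to be estimated by components.
  The second conclusion makes the factor in front nonnegative, so that a larger length may replace
  it.\<close>

lemma gapped_zero_norm_le:
  fixes q :: quat
  assumes n0: "n 0 = 0"
    and mono: "\<And>l. l < k \<Longrightarrow> n l < n (Suc l)"
    and lead: "a (n k) \<noteq> 0"
    and neq: "\<And>l. l < k \<Longrightarrow> a (n l) \<noteq> a (n (Suc l))"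
    and zero: "(\<Sum>\<nu>=0..k. q ^ n \<nu> * a (n \<nu>)) = 0"
  shows "norm q \<le> gap_bound n a k / norm (a (n k)) *
      (norm (a 0) + (\<Sum>l<k. norm (a (n (Suc l)) - a (n l))))"
    and "1 \<le> gap_bound n a k"
proof -
  let ?M = "gap_bound n a k" and ?V = "norm (a 0) + (\<Sum>l<k. norm (a (n (Suc l)) - a (n l)))"
  \<comment> \<open>For \<open>k = 0\<close> the polynomial is a nonzero constant and has no zero.
    Hence the maximum in \<open>gap_bound\<close> is over a nonempty set.\<close>
  have "k \<noteq> 0"
    using zero lead n0 by (intro notI) simp
  then have "1 \<le> gap_max n a 1"
    using neq[of 0] by (intro one_le_gap_max) auto
  also have "\<dots> \<le> ?M"
    using \<open>k \<noteq> 0\<close> by (intro gap_max_le_gap_bound) auto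
  finally show M: "1 \<le> ?M" .
  have V: "norm (a (n k)) \<le> ?V"
    using norm_le_norm_first_plus_variation[of "\<lambda>l. a (n l)" k] n0 by simp
  have "0 \<le> ?V"
    by (intro add_nonneg_nonneg sum_nonneg) auto
  have "norm q * norm (a (n k)) \<le> ?M * ?V"
  proof (cases "1 \<le> norm q")
    case False
    then have "norm q * norm (a (n k)) \<le> 1 * norm (a (n k))"
      by (intro mult_right_mono) auto
    also have "\<dots> \<le> ?M * ?V"
      using M V by (intro mult_mono) auto
    finally show ?thesis .
  next
    case True
    define g where "g l = q ^ n (Suc l) * a (n (Suc l)) - q ^ (n l + 1) * a (n l)" for l
    have le_nk: "n l \<le> n k" if "l \<le> k" for l
      using that
    proof (induction rule: inc_induct)
      case (step i)
      then show ?case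
        using mono[of i] by simp
    qed simp
    have g: "norm (g l) \<le> ?M * norm (a (n (Suc l)) - a (n l)) * norm q ^ n k" if "l < k" for l
    proof -
      have "norm (g l) \<le> gap_max n a (Suc l) * norm (a (n (Suc l)) - a (n l)) * norm q ^ n (Suc l)"
        unfolding g_def using norm_gap_le[of n "Suc l" a q] mono[OF that] neq[OF that] True by simp
      \<comment> \<open>Constant and exponent are both raised to values independent of
        \<open>l\<close>, the exponent because \<open>1 \<le> norm q\<close>.\<close>
      also have "\<dots> \<le> ?M * norm (a (n (Suc l)) - a (n l)) * norm q ^ n k"
        using that M True le_nk[of "Suc l"]
        by (intro mult_mono gap_max_le_gap_bound power_increasing) auto
      finally show ?thesis .
    qed
    have "q ^ (n k + 1) * a (n k) = a 0 + (\<Sum>l<k. g l)"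
      using one_minus_times_gapped_sum[of q n "\<lambda>l. a (n l)" k] zero n0 by (simp add: g_def)
    then have "norm q ^ (n k + 1) * norm (a (n k)) = norm (a 0 + (\<Sum>l<k. g l))"
      by (metis norm_mult norm_power)
    also have "\<dots> \<le> norm (a 0) + (\<Sum>l<k. norm (g l))"
      by (intro norm_triangle_le add_left_mono norm_sum)
    also have "\<dots> \<le> ?M * norm (a 0) * norm q ^ n k
        + (\<Sum>l<k. ?M * norm (a (n (Suc l)) - a (n l)) * norm q ^ n k)"
    \<comment> \<open>The constant term gets the same factors, each at least 1, so that they can be
      pulled out of the whole sum.\<close>
    proof (intro add_mono sum_mono g)
      have "1 * norm (a 0) * 1 \<le> ?M * norm (a 0) * norm q ^ n k"
        using M True by (intro mult_mono) auto
      then show "norm (a 0) \<le> ?M * norm (a 0) * norm q ^ n k"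
        by simp
    qed auto
    also have "\<dots> = norm q ^ n k * (?M * ?V)"
      by (simp add: sum_distrib_left algebra_simps)
    finally have "norm q ^ n k * (norm q * norm (a (n k))) \<le> norm q ^ n k * (?M * ?V)"
      by (simp add: mult_ac)
    moreover have "0 < norm q ^ n k"
      using True by (intro zero_less_power) linarith
    ultimately show ?thesis
      by (simp only: mult_le_cancel_left_pos)
  qed
  then show "norm q \<le> ?M / norm (a (n k)) * ?V"
    using lead by (simp add: field_simps)
qed

section \<open>Variation of the real components\<close>

lemma quat_norm_le_sum_abs: "norm x \<le> \<bar>qRe x\<bar> + \<bar>qIm1 x\<bar> + \<bar>qIm2 x\<bar> + \<bar>qIm3 x\<bar>"
proof -
  have "norm x = L2_set (\<lambda>i. [qRe x, qIm1 x, qIm2 x, qIm3 x] ! i) {..<4}"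
    by (simp add: norm_quat_def L2_set_def eval_nat_numeral)
  also have "\<dots> \<le> (\<Sum>i<4. \<bar>[qRe x, qIm1 x, qIm2 x, qIm3 x] ! i\<bar>)"
    by (rule L2_set_le_sum_abs)
  finally show ?thesis
    by (simp add: eval_nat_numeral)
qed

lemma sum_abs_diff_incseq:
  fixes f :: "nat \<Rightarrow> real"
  assumes "\<And>l. l < k \<Longrightarrow> f l \<le> f (Suc l)"
  shows "(\<Sum>l<k. \<bar>f (Suc l) - f l\<bar>) = f k - f 0"
  using assms by (induction k) auto

text \<open>The rise contributes \<open>f r - f 0\<close> and the fall \<open>f r - f k\<close>.
  Taking \<open>r = 0\<close> covers nonincreasing sequences.\<close>

lemma sum_abs_diff_unimodal:
  fixes f :: "nat \<Rightarrow> real"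
  assumes "r \<le> k"
    and inc: "\<And>l. l < r \<Longrightarrow> f l \<le> f (Suc l)"
    and dec: "\<And>l. r \<le> l \<Longrightarrow> l < k \<Longrightarrow> f (Suc l) \<le> f l"
  shows "(\<Sum>l<k. \<bar>f (Suc l) - f l\<bar>) = 2 * f r - (f 0 + f k)"
  using \<open>r \<le> k\<close> dec
proof (induction k rule: dec_induct)
  case base
  then show ?case
    using sum_abs_diff_incseq[of r f] inc by simp
next
  case (step k)
  then show ?case
    using step.prems[of k] by simp
qed

text \<open>By the triangle inequality: interior values occur in two differences, \<open>f k\<close>
  in one, and \<open>f 0\<close> in one besides the extra term.\<close>

lemma sum_abs_diff_le:
  fixes f :: "nat \<Rightarrow> real"
  shows "\<bar>f 0\<bar> + (\<Sum>l<k. \<bar>f (Suc l) - f l\<bar>) \<le> 2 * (\<Sum>l<k. \<bar>f l\<bar>) + \<bar>f k\<bar>"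
  by (induction k) auto

theorem theorem2p2:
  fixes k r :: nat
    and n :: "nat \<Rightarrow> nat"
    and a :: "nat \<Rightarrow> quat"
    and \<alpha> \<beta> \<gamma> \<delta> :: "nat \<Rightarrow> real"
    and p :: "quat \<Rightarrow> quat"
  assumes "n 0 = 0"
    and "\<And>l. l < k \<Longrightarrow> n l < n (Suc l)"
    and "\<And>q. p q = (\<Sum>\<nu>=0..k. q ^ n \<nu> * a (n \<nu>))"
    and "a (n k) \<noteq> 0"
    and "\<And>l. l \<le> k \<Longrightarrow>
           a (n l) = of_real (\<alpha> (n l)) + of_real (\<beta> (n l)) * quat_i
                   + of_real (\<gamma> (n l)) * quat_j + of_real (\<delta> (n l)) * quat_k"
    and "\<And>l. l < k \<Longrightarrow> a (n l) \<noteq> a (n (Suc l))"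
    and "\<And>l. l < k \<Longrightarrow> \<alpha> (n l) \<le> \<alpha> (n (Suc l))"
    and "\<And>l. l < k \<Longrightarrow> \<beta> (n l) \<ge> \<beta> (n (Suc l))"
    and "r \<le> k"
    and "\<And>l. l < r \<Longrightarrow> \<gamma> (n l) \<le> \<gamma> (n (Suc l))"
    and "\<And>l. r \<le> l \<Longrightarrow> l < k \<Longrightarrow> \<gamma> (n l) \<ge> \<gamma> (n (Suc l))"
  shows "\<forall>q. p q = 0 \<longrightarrow>
    norm q \<le> gap_bound n a k / norm (a (n k)) *
      ((\<alpha> (n k) - \<alpha> 0) + (\<beta> 0 - \<beta> (n k)) + 2 * \<gamma> (n r) - (\<gamma> 0 + \<gamma> (n k))
       + 2 * (\<Sum>j=0..<k. \<bar>\<delta> (n j)\<bar>) + \<bar>\<delta> (n k)\<bar> + \<bar>\<alpha> 0\<bar> + \<bar>\<beta> 0\<bar> + \<bar>\<gamma> 0\<bar>)"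
    (is "\<forall>q. _ \<longrightarrow> _ \<le> _ * ?B")
proof (intro allI impI)
  fix q
  assume "p q = 0"
  then have zero: "(\<Sum>\<nu>=0..k. q ^ n \<nu> * a (n \<nu>)) = 0"
    using assms(3) by simp
  note zero_bound = gapped_zero_norm_le[of n k a q, OF assms(1,2,4,6) zero]
  have coeff: "a (n l) = Quat (\<alpha> (n l)) (\<beta> (n l)) (\<gamma> (n l)) (\<delta> (n l))" if "l \<le> k" for l
    using assms(5)[OF that] by (simp add: quat_decomposition)
  have "norm (a 0) \<le> \<bar>\<alpha> 0\<bar> + \<bar>\<beta> 0\<bar> + \<bar>\<gamma> 0\<bar> + \<bar>\<delta> 0\<bar>"
    using quat_norm_le_sum_abs[of "a 0"] coeff[of 0] assms(1) by simp
  moreover have "(\<Sum>l<k. norm (a (n (Suc l)) - a (n l)))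
      \<le> (\<Sum>l<k. \<bar>\<alpha> (n (Suc l)) - \<alpha> (n l)\<bar>) + (\<Sum>l<k. \<bar>\<beta> (n (Suc l)) - \<beta> (n l)\<bar>)
        + (\<Sum>l<k. \<bar>\<gamma> (n (Suc l)) - \<gamma> (n l)\<bar>) + (\<Sum>l<k. \<bar>\<delta> (n (Suc l)) - \<delta> (n l)\<bar>)"
    unfolding sum.distrib[symmetric]
  proof (rule sum_mono)
    fix l
    assume "l \<in> {..<k}"
    then show "norm (a (n (Suc l)) - a (n l)) \<le> \<bar>\<alpha> (n (Suc l)) - \<alpha> (n l)\<bar>
      + \<bar>\<beta> (n (Suc l)) - \<beta> (n l)\<bar> + \<bar>\<gamma> (n (Suc l)) - \<gamma> (n l)\<bar> + \<bar>\<delta> (n (Suc l)) - \<delta> (n l)\<bar>"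
      using quat_norm_le_sum_abs[of "a (n (Suc l)) - a (n l)"] by (simp add: coeff)
  qed
  moreover have "(\<Sum>l<k. \<bar>\<alpha> (n (Suc l)) - \<alpha> (n l)\<bar>) = \<alpha> (n k) - \<alpha> 0"
    using sum_abs_diff_incseq[of k "\<lambda>l. \<alpha> (n l)"] assms(1,7) by simp
  \<comment> \<open>The unimodal case with its peak at index 0.\<close>
  moreover have "(\<Sum>l<k. \<bar>\<beta> (n (Suc l)) - \<beta> (n l)\<bar>) = \<beta> 0 - \<beta> (n k)"
    using sum_abs_diff_unimodal[of 0 k "\<lambda>l. \<beta> (n l)"] assms(1,8) by simp
  moreover have "(\<Sum>l<k. \<bar>\<gamma> (n (Suc l)) - \<gamma> (n l)\<bar>) = 2 * \<gamma> (n r) - (\<gamma> 0 + \<gamma> (n k))"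
    using sum_abs_diff_unimodal[of r k "\<lambda>l. \<gamma> (n l)"] assms(1,9-11) by simp
  \<comment> \<open>The term \<open>\<bar>\<delta> 0\<bar>\<close> left over from
    \<open>norm (a 0)\<close> is absorbed into the doubled sum.\<close>
  moreover have "\<bar>\<delta> 0\<bar> + (\<Sum>l<k. \<bar>\<delta> (n (Suc l)) - \<delta> (n l)\<bar>)
      \<le> 2 * (\<Sum>j=0..<k. \<bar>\<delta> (n j)\<bar>) + \<bar>\<delta> (n k)\<bar>"
    using sum_abs_diff_le[of "\<lambda>l. \<delta> (n l)" k] assms(1) by (simp add: atLeast0LessThan)
  ultimately have "norm (a 0) + (\<Sum>l<k. norm (a (n (Suc l)) - a (n l))) \<le> ?B"
    by linarith
  then have "gap_bound n a k / norm (a (n k))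
        * (norm (a 0) + (\<Sum>l<k. norm (a (n (Suc l)) - a (n l))))
      \<le> gap_bound n a k / norm (a (n k)) * ?B"
    using zero_bound(2) by (intro mult_left_mono) auto
  then show "norm q \<le> gap_bound n a k / norm (a (n k)) * ?B"
    using zero_bound(1) by linarith
qed

end
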